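(* Let $n\ge 4$, let $\Sigma$ be a binary alphabet (i.e. $|\Sigma|=2$), let $G$ be a finite abelian group (written additively), let $f:\Sigma^*\to G$ be a monoid morphism, and let $h:\Sigma^*\to\Sigma^*$ be a morphism. Assume that: (D1) The frequency matrix of $h$ is non-singular. (D2) $f(h(\sigma))=0$ for each $\sigma\in\Sigma$. (D3) The set $A=f(\operatorname{Pref}(h))\subseteq G$ does not contain a non-trivial arithmetic progression of length $n+1$, i.e. $\operatorname{a-rk}(A)\le n$. (D4) $f$ is $h$-injective: for any positive integer $r$, if $f(v_1)=\cdots=f(v_r)$ with $v_i\in\operatorname{Pref}(h)\setminus h(\Sigma)$ for $i\in\{1,\dots,r\}$, then either $v_1=\cdots=v_r$ or $v_1'=\cdots=v_r'$, where $v_iv_i'=h(\sigma_{j_i})$ for some $\sigma_{j_i}\in\Sigma$. Let $G_h$ be the subgroup of $\mathbb{Z}^\Sigma$ generated by $\psi(h(\Sigma))$, let $\mathcal{P}=\psi(\operatorname{Pref}(h))$, and let $\overline{\mathcal{P}}$ be the image of $\mathcal{P}$ in $\mathbb{Z}^\Sigma/G_h$. Then $h$ satisfies: (O1) The frequency matrix of $h$ is non-singular. (O2) $\operatorname{a-rk}(\overline{\mathcal{P}})\le n$. (O3) For every $v\in\mathcal{P}\setminus(\psi(h(\Sigma))\cup\{0\})$, the equivalence class $[v]_{\mathcal{P}}=\{w\in\mathcal{P}: w-v\in G_h\}$ contains at most $2$ elements, and the Parikh vector of a non-empty proper prefix of $h$ (that is, of a non-empty proper prefix of $h(\sigma)$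 for some $\sigma\in\Sigma$) is not in the equivalence class of the zero vector $0\in\mathbb{Z}^\Sigma$ modulo $G_h$. Moreover, if $[v]_{\mathcal{P}}=\{v,w\}$ with $v\ne w$, then $v-w=\psi(h(p))-\psi(h(q))$ for unique $p,q\in\Sigma$ where $v\in\psi(\operatorname{Pref}(h(p)))$ and $w\in\psi(\operatorname{Pref}(h(q)))$.
   Context: $\Sigma^*$ is the free monoid of finite words over $\Sigma=\{\sigma_1,\dots,\sigma_m\}$ (here $m=2$), with empty word $\epsilon$; $\mathbb{Z}^\Sigma$ is the free $\mathbb{Z}$-module on $\Sigma$. A morphism $h:\Sigma^*\to\Sigma^*$ is a monoid homomorphism. The Parikh vector $\psi(u)\in\mathbb{N}^m\subset\mathbb{Z}^\Sigma$ of a word $u$ has $i$-th coordinate the number of occurrences of $\sigma_i$ in $u$. For a set of words $S$, $\psi(S)=\{\psi(u):u\in S\}$; $h(\Sigma)=\{h(\sigma):\sigma\in\Sigma\}$. The frequency matrix of $h$ is the $m\times m$ matrix whose $i$-th row is $\psi(h(\sigma_i))$. $\operatorname{Pref}(u)$ is the set of all prefixes of $u$ (including $\epsilon$ and $u$), and $\operatorname{Pref}(h)=\bigcup_{\sigma\in\Sigma}\operatorname{Pref}(h(\sigma))$. For an abelian group $G$ an arithmetic progression of length $k$ in $G$ is a sequence $a,a+d,\dots,a+(k-1)d$ with $a,d\in G$; it is trivial if $d=0$. For $A\subseteq G$, $\operatorname{a-rk}(A)$ is the length of a longest non-trivial arithmetic progression all of whose terms lie in $A$ (terms may repeat), and $\operatorname{a-rk}(A)=\infty$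 if these lengths are unbounded.
   Formalization: In (O3), the clause on non-empty proper prefixes is proved only for prefixes not in h(Σ); otherwise it is false: h(a)=a, h(b)=ab, f=0, G trivial satisfies (D1)–(D4), but a is a proper prefix of h(b) with ψ(a)=ψ(h(a)) in G_h. *)

theory Defs
  imports
    "HOL-Analysis.Determinants"
    "HOL-Algebra.Generated_Groups"
    "HOL-Library.Extended_Nat"
    "HOL-Library.Sublist"
begin

text \<open>The alphabet is the finite type \<open>'a\<close>, words are lists over it, and the free module
  \<open>Z^\<Sigma>\<close> is \<open>int ^ 'a\<close>. Abelian groups are groups in the sense of HOL-Algebra and hence
  written multiplicatively: \<open>\<one>\<close> is the zero element and \<open>d [^] i\<close> is the multiple \<open>i d\<close>.\<close>

definition word_monoid :: "'a list monoid" where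
  "word_monoid = \<lparr>carrier = UNIV, monoid.mult = (@), one = []\<rparr>"

definition monoid_morphism ::
    "('a, 'c) monoid_scheme \<Rightarrow> ('b, 'd) monoid_scheme \<Rightarrow> ('a \<Rightarrow> 'b) \<Rightarrow> bool" where
  "monoid_morphism M N \<phi> \<longleftrightarrow> \<phi> \<in> hom M N \<and> \<phi> \<one>\<^bsub>M\<^esub> = \<one>\<^bsub>N\<^esub>"

definition parikh :: "'a::finite list \<Rightarrow> int ^ 'a" where
  "parikh u = (\<chi> s. int (count_list u s))"

definition letter_images :: "('a list \<Rightarrow> 'a list) \<Rightarrow> 'a list set" where
  "letter_images h = (\<lambda>s. h [s]) ` UNIV"

definition frequency_matrix :: "('a::finite list \<Rightarrow> 'a list) \<Rightarrow> int ^ 'a ^ 'a" where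
  "frequency_matrix h = (\<chi> s. parikh (h [s]))"

definition Pref :: "'a list \<Rightarrow> 'a list set" where
  "Pref u = {v. prefix v u}"

definition Pref_morphism :: "('a list \<Rightarrow> 'a list) \<Rightarrow> 'a list set" where
  "Pref_morphism h = (\<Union>s. Pref (h [s]))"

text \<open>The supremum is over the lengths of all non-trivial progressions in \<open>A\<close>; it is \<open>\<infinity>\<close> exactly
  when these lengths are unbounded.\<close>

definition a_rk :: "('g, 'b) monoid_scheme \<Rightarrow> 'g set \<Rightarrow> enat" where
  "a_rk G A = (SUP k \<in> {k. \<exists>a\<in>carrier G. \<exists>d\<in>carrier G. d \<noteq> \<one>\<^bsub>G\<^esub> \<and>
     (\<forall>i<k. a \<otimes>\<^bsub>G\<^esub> d [^]\<^bsub>G\<^esub> i \<in> A)}. enat k)"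

text \<open>A word \<open>v i\<close> may be a prefix of the images of several letters, so that \<open>v' i\<close> is not
  determined by \<open>v i\<close>. The condition is required for every choice of the factorizations
  \<open>v i @ v' i = h [j i]\<close>.\<close>

definition h_injective :: "('a list \<Rightarrow> 'a list) \<Rightarrow> ('a list \<Rightarrow> 'g) \<Rightarrow> bool" where
  "h_injective h f \<longleftrightarrow> (\<forall>r>0. \<forall>(v :: nat \<Rightarrow> 'a list) (v' :: nat \<Rightarrow> 'a list) (j :: nat \<Rightarrow> 'a).
     (\<forall>i<r. v i \<in> Pref_morphism h - letter_images h \<and> v i @ v' i = h [j i]) \<and>
     (\<forall>i<r. \<forall>k<r. f (v i) = f (v k)) \<longrightarrow>
     (\<forall>i<r. \<forall>k<r. v i = v k) \<or> (\<forall>i<r. \<forall>k<r. v' i = v' k))"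

definition Z_Sigma :: "(int ^ 'a::finite) monoid" where
  "Z_Sigma = \<lparr>carrier = UNIV, monoid.mult = (+), one = 0\<rparr>"

definition image_subgroup :: "('a::finite list \<Rightarrow> 'a list) \<Rightarrow> (int ^ 'a) set" where
  "image_subgroup h = generate Z_Sigma (parikh ` letter_images h)"

definition prefix_vectors :: "('a::finite list \<Rightarrow> 'a list) \<Rightarrow> (int ^ 'a) set" where
  "prefix_vectors h = parikh ` Pref_morphism h"

definition prefix_cosets :: "('a::finite list \<Rightarrow> 'a list) \<Rightarrow> (int ^ 'a) set set" where
  "prefix_cosets h = (\<lambda>v. image_subgroup h #>\<^bsub>Z_Sigma\<^esub> v) ` prefix_vectors h"

definition prefix_class :: "('a::finite list \<Rightarrow> 'a list) \<Rightarrow> int ^ 'a \<Rightarrow> (int ^ 'a) set" where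
  "prefix_class h v = {w \<in> prefix_vectors h. w - v \<in> image_subgroup h}"

end

theory Submission
  imports Defs "HOL-Algebra.FiniteProduct"
begin

text \<open>The morphism \<open>f\<close> factors through the Parikh map, and by (D2) the induced homomorphism on
  \<open>Z^\<Sigma>\<close> kills \<open>G_h\<close>; hence words with congruent Parikh vectors have the same \<open>f\<close>-value.
  Conversely, (D4) for two words shows that \<open>f\<close> separates the classes of prefixes modulo \<open>G_h\<close>:
  prefixes with the same \<open>f\<close>-value that are not equal leave the same remainder in their images, so
  their Parikh vectors differ by \<open>\<psi>(h(p)) - \<psi>(h(q))\<close>. So a non-trivial progression in the quotient
  maps to a non-trivial progression in \<open>G\<close>.\<close>

section \<open>The free abelian group on the alphabet and the subgroup
  \<open>image_subgroup h\<close>\<close>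

lemma comm_group_Z_Sigma: "comm_group (Z_Sigma :: (int ^ 'a::finite) monoid)"
  by (rule comm_groupI) (auto simp: Z_Sigma_def algebra_simps intro: exI[of _ "- x" for x])

lemma Z_Sigma_simps [simp]:
  "carrier Z_Sigma = UNIV" "x \<otimes>\<^bsub>Z_Sigma\<^esub> y = x + y" "\<one>\<^bsub>Z_Sigma\<^esub> = 0"
  by (auto simp: Z_Sigma_def)

lemma subgroup_image_subgroup: "subgroup (image_subgroup h) Z_Sigma"
  unfolding image_subgroup_def
  by (rule group.generate_is_subgroup)
    (auto intro: comm_group.axioms(2)[OF comm_group_Z_Sigma])

lemma inv_Z_Sigma [simp]: "inv\<^bsub>Z_Sigma\<^esub> x = - (x :: int ^ 'a::finite)"
  using group.inv_equality[OF comm_group.axioms(2)[OF comm_group_Z_Sigma], of "- x" x] by simp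

lemma zero_in_image_subgroup: "0 \<in> image_subgroup h"
  using subgroup.one_closed[OF subgroup_image_subgroup] by simp

lemma minus_in_image_subgroup:
  "x \<in> image_subgroup h \<Longrightarrow> y \<in> image_subgroup h \<Longrightarrow> x - y \<in> image_subgroup h"
  using subgroup.m_closed[OF subgroup_image_subgroup, of x h "- y"]
    subgroup.m_inv_closed[OF subgroup_image_subgroup, of y h] by simp

lemma parikh_letter_image_in_image_subgroup: "parikh (h [s]) \<in> image_subgroup h"
  unfolding image_subgroup_def letter_images_def by (rule generate.incl) auto

lemma coset_eq_iff:
  assumes "subgroup H (Z_Sigma :: (int ^ 'a::finite) monoid)"
  shows "H #>\<^bsub>Z_Sigma\<^esub> x = H #>\<^bsub>Z_Sigma\<^esub> y \<longleftrightarrow> x - y \<in> H"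
proof -
  interpret Z: comm_group "Z_Sigma :: (int ^ 'a) monoid" by (rule comm_group_Z_Sigma)
  have "H #>\<^bsub>Z_Sigma\<^esub> x = H #>\<^bsub>Z_Sigma\<^esub> y" if "x - y \<in> H"
  proof (rule Z.repr_independence[symmetric, OF _ _ assms])
    show "x \<in> H #>\<^bsub>Z_Sigma\<^esub> y"
      using that unfolding r_coset_def by (auto intro!: bexI[of _ "x - y"])
  qed simp
  moreover have "x - y \<in> H" if "H #>\<^bsub>Z_Sigma\<^esub> x = H #>\<^bsub>Z_Sigma\<^esub> y"
  proof -
    have "x \<in> H #>\<^bsub>Z_Sigma\<^esub> y" using Z.rcos_self[OF _ assms, of x] that by simp
    then show ?thesis by (auto simp: r_coset_def)
  qed
  ultimately show ?thesis by blast
qed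

section \<open>Parikh vectors, images of letters and their prefixes\<close>

lemma parikh_Nil [simp]: "parikh [] = 0"
  by (simp add: parikh_def vec_eq_iff)

lemma parikh_append [simp]: "parikh (u @ v) = parikh u + parikh v"
  by (simp add: parikh_def vec_eq_iff)

text \<open>An empty image would produce a zero row of the frequency matrix. This keeps the empty
  word out of \<open>letter_images h\<close>, so that (D4) may be applied to it.\<close>

lemma letter_image_neq_Nil:
  assumes "det (frequency_matrix h) \<noteq> 0"
  shows "h [s] \<noteq> []"
proof
  assume "h [s] = []"
  then have "row s (frequency_matrix h) = 0"
    by (simp add: frequency_matrix_def row_def vec_eq_iff)
  then show False using det_zero_row(1) assms by blast
qed

lemma Pref_morphismI: "u @ u' = h [s] \<Longrightarrow> u \<in> Pref_morphism h"
  unfolding Pref_morphism_def Pref_def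
  by (intro UN_I[of s] CollectI prefixI[of _ _ u']) simp_all

lemma Pref_morphismE:
  assumes "u \<in> Pref_morphism h"
  obtains u' s where "u @ u' = h [s]"
proof -
  from assms obtain s where "prefix u (h [s])" unfolding Pref_morphism_def Pref_def by blast
  then obtain u' where "h [s] = u @ u'" by (rule prefixE)
  then show thesis using that[of u' s] by simp
qed

section \<open>The homomorphism on the free abelian group determined by values on the
  letters\<close>

definition (in comm_group) weighted_product :: "('s \<Rightarrow> 'a) \<Rightarrow> int ^ 's \<Rightarrow> 'a" where
  "weighted_product g x = (\<Otimes>\<^bsub>G\<^esub>s\<in>UNIV. g s [^] (x $ s))"

lemma (in comm_group) weighted_product_hom:
  fixes g :: "'s::finite \<Rightarrow> 'a"
  assumes "range g \<subseteq> carrier G"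
  shows "group_hom Z_Sigma G (weighted_product g)"
proof -
  have [simp]: "g s \<in> carrier G" for s using assms by auto
  have "weighted_product g \<in> hom Z_Sigma G"
    by (rule homI) (auto simp: weighted_product_def finprod_multf int_pow_mult Pi_def)
  then show ?thesis
    by (intro group_hom.intro group_hom_axioms.intro is_group
        comm_group.axioms(2)[OF comm_group_Z_Sigma])
qed

text \<open>Both sides turn concatenation into products and agree on single letters, where only one
  exponent is nonzero.\<close>

lemma (in comm_group) weighted_product_parikh:
  fixes f :: "'s::finite list \<Rightarrow> 'a"
  assumes "monoid_morphism word_monoid G f"
  shows "weighted_product (\<lambda>s. f [s]) (parikh u) = f u"
proof -
  have carr [simp]: "f v \<in> carrier G" for v
    using assms unfolding monoid_morphism_def word_monoid_def hom_def by auto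
  have app: "f (v @ w) = f v \<otimes> f w" for v w
    using assms unfolding monoid_morphism_def word_monoid_def hom_def by auto
  interpret W: group_hom Z_Sigma G "weighted_product (\<lambda>s. f [s])"
    by (rule weighted_product_hom) auto
  show ?thesis
  proof (induction u)
    case Nil
    then show ?case
      using W.hom_one assms unfolding monoid_morphism_def word_monoid_def by simp
  next
    case (Cons s u)
    have "weighted_product (\<lambda>s. f [s]) (parikh [s]) = (\<Otimes>\<^bsub>G\<^esub>t\<in>UNIV. if s = t then f [t] else \<one>)"
      unfolding weighted_product_def by (rule finprod_cong') (auto simp: parikh_def)
    also have "\<dots> = f [s]" by (simp add: finprod_singleton)
    finally show ?case
      using Cons W.hom_mult[of "parikh [s]" "parikh u"] app[of "[s]" u] parikh_append[of "[s]" u]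
      by simp
  qed
qed

section \<open>Values of prefixes under (D1), (D2) and (D4)\<close>

locale injective_morphism = comm_group G
  for G :: "('g, 'b) monoid_scheme" (structure) +
  fixes f :: "'s::finite list \<Rightarrow> 'g" and h :: "'s list \<Rightarrow> 's list"
  assumes morphism: "monoid_morphism word_monoid G f"
    and nonsingular: "det (frequency_matrix h) \<noteq> 0"
    and letter_image_eq_one: "f (h [s]) = \<one>"
    and injective: "h_injective h f"
begin

abbreviation vector_value :: "int ^ 's \<Rightarrow> 'g" where
  "vector_value \<equiv> weighted_product (\<lambda>s. f [s])"

lemma group_hom_vector_value: "group_hom Z_Sigma G vector_value"
  using morphism
  by (intro weighted_product_hom) (auto simp: monoid_morphism_def word_monoid_def hom_def)

sublocale vector_value: group_hom Z_Sigma G vector_value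
  by (rule group_hom_vector_value)

lemmas vector_value_parikh = weighted_product_parikh[OF morphism]

text \<open>By (D2) the generators of the subgroup lie in the kernel of \<open>vector_value\<close>,
  and the kernel is a subgroup.\<close>

lemma vector_value_image_subgroup:
  assumes "x \<in> image_subgroup h"
  shows "vector_value x = \<one>"
proof -
  have "image_subgroup h \<subseteq> kernel Z_Sigma G vector_value"
    unfolding image_subgroup_def
    by (rule vector_value.G.generate_subgroup_incl[OF _ vector_value.subgroup_kernel])
      (auto simp: letter_images_def kernel_def vector_value_parikh letter_image_eq_one)
  then show ?thesis using assms by (auto simp: kernel_def)
qed

lemma vector_value_cong:
  assumes "x - y \<in> image_subgroup h"
  shows "vector_value x = vector_value y"
  using vector_value.hom_mult[of "x - y" y] vector_value_image_subgroup[OF assms] by simp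

text \<open>This is (D4) for families of \<open>r = 2\<close> words.\<close>

lemma equal_value_cases:
  assumes "f u = f v" and "u @ u' = h [s]" and "v @ v' = h [t]"
    and "u \<notin> letter_images h" and "v \<notin> letter_images h"
  shows "u = v \<or> u' = v'"
proof -
  have mem: "u \<in> Pref_morphism h" "v \<in> Pref_morphism h"
    using Pref_morphismI[of _ _ h] assms(2,3) by blast+
  have all_less_2: "(\<forall>i<2. P i) \<longleftrightarrow> P 0 \<and> P 1" for P :: "nat \<Rightarrow> bool"
    by (auto simp: less_2_cases_iff)
  \<comment> \<open>The two factorizations are coded as sequences; only the indices 0 and 1 matter,
    so the value at larger indices is arbitrary.\<close>
  show ?thesis
    using injective[unfolded h_injective_def, THEN spec, THEN mp, of 2, THEN spec, THEN spec,
        THEN spec, of "\<lambda>i. if i = 0 then u else v" "\<lambda>i. if i = 0 then u' else v'"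
        "\<lambda>i. if i = 0 then s else t"]
      assms mem by (simp add: all_less_2) blast
qed

lemma Nil_notin_letter_images: "[] \<notin> letter_images h"
  unfolding letter_images_def
proof (rule notI, erule rangeE)
  fix s
  assume "[] = h [s]"
  with letter_image_neq_Nil[OF nonsingular, of s] show False by (rule notE[OF _ sym])
qed

lemma f_Nil: "f [] = \<one>"
  using morphism by (simp add: monoid_morphism_def word_monoid_def)

text \<open>Comparing with the empty prefix of \<open>h(\<sigma>)\<close>, (D4) would make the remainder equal to
  \<open>h(\<sigma>)\<close>.\<close>

lemma value_one_iff:
  assumes "u \<in> Pref_morphism h"
  shows "f u = \<one> \<longleftrightarrow> u = [] \<or> u \<in> letter_images h"
proof
  assume one: "f u = \<one>"
  obtain u' s where u': "u @ u' = h [s]" using assms by (rule Pref_morphismE)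
  show "u = [] \<or> u \<in> letter_images h"
    using equal_value_cases[of u "[]" u' s "h [s]" s] one u' Nil_notin_letter_images f_Nil
    by auto
qed (auto simp: f_Nil letter_images_def letter_image_eq_one)

text \<open>This is the converse of \<open>vector_value_cong\<close> on prefixes. Trivial values are
  treated apart because (D4) excludes letter images: by \<open>value_one_iff\<close> the words
  concerned are empty or letter images, with Parikh vectors in the subgroup. Otherwise (D4) applies,
  and a common remainder cancels, leaving a difference of two generators.\<close>

lemma equal_value_imp_congruent:
  assumes "u \<in> Pref_morphism h" "v \<in> Pref_morphism h" and "f u = f v"
  shows "parikh u - parikh v \<in> image_subgroup h"
proof (cases "f u = \<one>")
  case True
  have "parikh w \<in> image_subgroup h" if "w \<in> Pref_morphism h" "f w = \<one>" for w
    using value_one_iff[OF that(1)] that(2)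
    by (auto simp: letter_images_def zero_in_image_subgroup parikh_letter_image_in_image_subgroup)
  with True assms have "parikh u \<in> image_subgroup h" "parikh v \<in> image_subgroup h"
    by simp_all
  then show ?thesis by (rule minus_in_image_subgroup)
next
  case False
  obtain u' s v' t where fact: "u @ u' = h [s]" "v @ v' = h [t]"
    using assms by (elim Pref_morphismE)
  have "u = v \<or> u' = v'"
    using equal_value_cases[OF assms(3) fact] False assms value_one_iff by metis
  then show ?thesis
  proof
    assume "u' = v'"
    then have "parikh u - parikh v = parikh (h [s]) - parikh (h [t])"
      by (simp flip: fact)
    then show ?thesis
      by (simp add: minus_in_image_subgroup parikh_letter_image_in_image_subgroup)
  qed (simp add: zero_in_image_subgroup)
qed

section \<open>Arithmetic progressions in the quotient, for (O2)\<close>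

lemma a_rk_prefix_cosets_le:
  assumes "a_rk G (f ` Pref_morphism h) \<le> enat n" and "n \<ge> 1"
  shows "a_rk (Z_Sigma Mod image_subgroup h) (prefix_cosets h) \<le> enat n"
  unfolding a_rk_def
proof (rule SUP_least, clarify)
  let ?H = "image_subgroup h" and ?Q = "Z_Sigma Mod image_subgroup h"
  interpret Z: comm_group "Z_Sigma :: (int ^ 's) monoid" by (rule comm_group_Z_Sigma)
  interpret N: normal ?H Z_Sigma
    by (rule Z.subgroup_imp_normal[OF subgroup_image_subgroup])
  interpret Q: group ?Q by (rule N.factorgroup_is_group)
  interpret C: group_hom Z_Sigma ?Q "\<lambda>x. ?H #>\<^bsub>Z_Sigma\<^esub> x"
    by unfold_locales (rule N.r_coset_hom_Mod)
  fix k :: nat and A D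
  assume A: "A \<in> carrier ?Q" and D: "D \<in> carrier ?Q" "D \<noteq> \<one>\<^bsub>?Q\<^esub>"
    and prog: "\<forall>i<k. A \<otimes>\<^bsub>?Q\<^esub> D [^]\<^bsub>?Q\<^esub> i \<in> prefix_cosets h"
  \<comment> \<open>Lift the start and the difference of the progression to vectors, on which
    \<open>vector_value\<close> is defined.\<close>
  obtain a where a: "A = ?H #>\<^bsub>Z_Sigma\<^esub> a"
    using A by (auto simp: FactGroup_def RCOSETS_def)
  obtain d where d: "D = ?H #>\<^bsub>Z_Sigma\<^esub> d"
    using D by (auto simp: FactGroup_def RCOSETS_def)
  have term_eq: "A \<otimes>\<^bsub>?Q\<^esub> D [^]\<^bsub>?Q\<^esub> i = ?H #>\<^bsub>Z_Sigma\<^esub> (a + d [^]\<^bsub>Z_Sigma\<^esub> i)" for i :: nat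
    using C.hom_mult[of a "d [^]\<^bsub>Z_Sigma\<^esub> i"] C.hom_nat_pow[of d i] by (simp add: a d)
  have "\<exists>u. \<forall>i<k. u i \<in> Pref_morphism h \<and>
      A \<otimes>\<^bsub>?Q\<^esub> D [^]\<^bsub>?Q\<^esub> i = ?H #>\<^bsub>Z_Sigma\<^esub> parikh (u i)"
    using prog unfolding prefix_cosets_def prefix_vectors_def by (intro choice) blast
  then obtain u where u: "u i \<in> Pref_morphism h"
      "A \<otimes>\<^bsub>?Q\<^esub> D [^]\<^bsub>?Q\<^esub> i = ?H #>\<^bsub>Z_Sigma\<^esub> parikh (u i)" if "i < k" for i
    by blast
  \<comment> \<open>The chosen prefix \<open>u i\<close> represents the same coset as the lifted
    term, and values depend only on cosets; hence the values of the prefixes form a progression in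
    \<open>G\<close>.\<close>
  have term_value: "vector_value a \<otimes> vector_value d [^] i = f (u i)" if "i < k" for i
  proof -
    have "(a + d [^]\<^bsub>Z_Sigma\<^esub> i) - parikh (u i) \<in> ?H"
      using trans[OF term_eq[symmetric] u(2)[OF that]] coset_eq_iff[OF subgroup_image_subgroup]
      by blast
    from vector_value_cong[OF this] show ?thesis
      using vector_value.hom_mult[of a "d [^]\<^bsub>Z_Sigma\<^esub> i"] vector_value.hom_nat_pow[of d i]
      by (simp add: vector_value_parikh)
  qed
  show "enat k \<le> enat n"
  proof (cases "vector_value d = \<one>")
    case False
    have "enat k \<le> a_rk G (f ` Pref_morphism h)"
      unfolding a_rk_def
    proof (rule SUP_upper, intro CollectI bexI conjI allI impI)
      show "vector_value a \<otimes> vector_value d [^] i \<in> f ` Pref_morphism h" if "i < k" for i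
        using u(1)[OF that] term_value[OF that] by simp
    qed (use False in simp_all)
    then show ?thesis using assms(1) by (rule order_trans)
  next
    case True
    \<comment> \<open>If the difference has trivial value, two terms would have prefixes of equal
      value, hence equal cosets, forcing \<open>D\<close> to be the identity.\<close>
    have "\<not> 1 < k"
    proof
      assume "1 < k"
      have "vector_value a \<otimes> vector_value d [^] i = vector_value a" for i :: nat
        using True vector_value.hom_closed[of a] by simp
      then have "f (u 0) = f (u 1)"
        using term_value[of 0] term_value[of 1] \<open>1 < k\<close> by (metis less_trans zero_less_one)
      then have "parikh (u 0) - parikh (u 1) \<in> ?H"
        using u(1) \<open>1 < k\<close> by (intro equal_value_imp_congruent) auto
      then have "A \<otimes>\<^bsub>?Q\<^esub> D [^]\<^bsub>?Q\<^esub> (0::nat) = A \<otimes>\<^bsub>?Q\<^esub> D [^]\<^bsub>?Q\<^esub> (1::nat)"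
        using u(2)[of 0] u(2)[of 1] \<open>1 < k\<close> coset_eq_iff[OF subgroup_image_subgroup]
        by (metis less_trans zero_less_one)
      then have "A = A \<otimes>\<^bsub>?Q\<^esub> D"
        using A D(1) by (simp only: One_nat_def Q.nat_pow_Suc Q.nat_pow_0 Q.l_one Q.r_one)
      then show False using A D Q.l_cancel_one' by blast
    qed
    \<comment> \<open>Progressions of length 0 or 1 remain; they are covered by
      \<open>n \<ge> 1\<close>.\<close>
    then show ?thesis using assms(2) by simp
  qed
qed

section \<open>Congruence classes of prefix vectors, for (O3)\<close>

lemma parikh_proper_prefix_notin_image_subgroup:
  assumes "strict_prefix u (h [s])" "u \<noteq> []" "u \<notin> letter_images h"
  shows "parikh u \<notin> image_subgroup h"
proof
  assume "parikh u \<in> image_subgroup h"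
  \<comment> \<open>By \<open>value_one_iff\<close>, a trivial value leaves only the empty word and
    the letter images, both excluded.\<close>
  then have "f u = \<one>" using vector_value_image_subgroup vector_value_parikh by metis
  moreover have "u \<in> Pref_morphism h"
    using assms(1) by (auto simp: Pref_morphism_def Pref_def strict_prefix_def)
  ultimately show False using value_one_iff assms by blast
qed

text \<open>Congruent prefixes have equal values. The value of \<open>u\<close> is nontrivial, since
  \<open>u\<close> is neither empty nor a letter image; so \<open>w\<close> is no letter image
  either, and (D4) applies to the pair.\<close>

lemma prefix_class_cases:
  assumes v: "parikh u \<notin> parikh ` letter_images h \<union> {0}" "u @ u' = h [s]"
    and w: "w @ w' = h [t]" "parikh w \<in> prefix_class h (parikh u)"
  shows "u = w \<or> u' = w'"
proof -
  have mem: "u \<in> Pref_morphism h" "w \<in> Pref_morphism h"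
    using Pref_morphismI[of _ _ h] v(2) w(1) by blast+
  have eq: "f u = f w"
    using w(2) vector_value_cong[of "parikh w" "parikh u"]
    by (simp add: prefix_class_def vector_value_parikh)
  have "u \<noteq> []" "u \<notin> letter_images h" using v(1) by auto
  then have "f u \<noteq> \<one>" using value_one_iff[OF mem(1)] by blast
  then have "w \<notin> letter_images h" using value_one_iff[OF mem(2)] eq by metis
  then show ?thesis using equal_value_cases[OF eq v(2) w(1)] \<open>u \<notin> letter_images h\<close> by blast
qed

text \<open>Fix one remainder \<open>u'\<close> of a prefix representing \<open>v\<close>. Every
  member of the class arises by subtracting \<open>parikh u'\<close> from the Parikh vector of some
  letter image, so the letters index the class.\<close>

lemma finite_card_prefix_class:
  assumes "v \<in> prefix_vectors h - (parikh ` letter_images h \<union> {0})"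
  shows "finite (prefix_class h v) \<and> card (prefix_class h v) \<le> CARD('s)"
proof -
  obtain u u' s where u: "v = parikh u" "u @ u' = h [s]"
    using assms by (auto simp: prefix_vectors_def elim: Pref_morphismE)
  have sub: "prefix_class h v \<subseteq> range (\<lambda>t. parikh (h [t]) - parikh u')"
  proof
    fix x assume x: "x \<in> prefix_class h v"
    then obtain w w' t where w: "x = parikh w" "w @ w' = h [t]"
      by (auto simp: prefix_class_def prefix_vectors_def elim: Pref_morphismE)
    have "u = w \<or> u' = w'"
      using prefix_class_cases[OF _ u(2) w(2)] assms x by (simp add: u(1) w(1))
    \<comment> \<open>The letter is \<open>s\<close> if the prefixes coincide and \<open>t\<close>
      if the remainders do.\<close>
    then show "x \<in> range (\<lambda>t. parikh (h [t]) - parikh u')"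
      by (auto simp: w(1) simp flip: u(2) w(2)
          intro: image_eqI[of _ _ s] image_eqI[of _ _ t])
  qed
  have "card (prefix_class h v) \<le> card (range (\<lambda>t. parikh (h [t]) - parikh u'))"
    by (rule card_mono[OF _ sub]) simp
  also have "\<dots> \<le> CARD('s)" by (rule card_image_le) simp
  finally show ?thesis using finite_subset[OF sub] by simp
qed

text \<open>Distinct vectors come from distinct prefixes, so the remainders agree and cancel in the
  difference. For uniqueness, two letters admit only the ordered pairs \<open>(p, q)\<close> and
  \<open>(q, p)\<close> of distinct entries, and swapping them changes the sign of the
  difference.\<close>

lemma ex1_letter_image_difference:
  assumes v: "v \<in> prefix_vectors h - (parikh ` letter_images h \<union> {0})"
    and w: "w \<in> prefix_class h v" "v \<noteq> w" and card: "CARD('s) = 2"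
  shows "\<exists>!(p, q). v - w = parikh (h [p]) - parikh (h [q]) \<and>
    v \<in> parikh ` Pref (h [p]) \<and> w \<in> parikh ` Pref (h [q])"
proof -
  obtain u u' p where u: "v = parikh u" "u @ u' = h [p]"
    using v by (auto simp: prefix_vectors_def elim: Pref_morphismE)
  obtain x x' q where x: "w = parikh x" "x @ x' = h [q]"
    using w by (auto simp: prefix_class_def prefix_vectors_def elim: Pref_morphismE)
  have "u = x \<or> u' = x'"
    using prefix_class_cases[OF _ u(2) x(2)] v w by (simp add: u(1) x(1))
  with w(2) u(1) x(1) have "u' = x'" by auto
  then have diff: "v - w = parikh (h [p]) - parikh (h [q])"
    by (simp add: u(1) x(1) flip: u(2) x(2))
  have pref: "v \<in> parikh ` Pref (h [p])" "w \<in> parikh ` Pref (h [q])"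
    by (auto simp: u(1) x(1) Pref_def simp flip: u(2) x(2))
  have "p \<noteq> q" using diff w(2) by auto
  then have UNIV: "UNIV = {p, q}"
    using card by (intro card_subset_eq[symmetric]) auto
  have "p' = p \<and> q' = q" if d: "v - w = parikh (h [p']) - parikh (h [q'])" for p' q'
  proof -
    have "p' \<noteq> q'" using d w(2) by auto
    moreover have "\<not> (p' = q \<and> q' = p)"
    proof
      assume "p' = q \<and> q' = p"
      \<comment> \<open>An integer vector equal to its own negative is zero, contradicting
        \<open>v \<noteq> w\<close>.\<close>
      then have "v - w = - (v - w)" using d diff by simp
      then show False using w(2) by (simp add: vec_eq_iff)
    qed
    moreover have "p' = p \<or> p' = q" "q' = p \<or> q' = q"
      using UNIV by blast+
    ultimately show ?thesis by blast
  qed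
  then show ?thesis using diff pref by (intro ex1I[of _ "(p, q)"]) auto
qed

end

theorem theorem2p10:
  fixes n :: nat
    and G :: "('g, 'b) monoid_scheme"
    and f :: "'a::finite list \<Rightarrow> 'g"
    and h :: "'a list \<Rightarrow> 'a list"
  assumes "n \<ge> 4"
    and "CARD('a) = 2"
    and "comm_group G" and "finite (carrier G)"
    and "monoid_morphism word_monoid G f"
    and "monoid_morphism word_monoid word_monoid h"
    and D1: "det (frequency_matrix h) \<noteq> 0"
    and D2: "\<And>s. f (h [s]) = \<one>\<^bsub>G\<^esub>"
    and D3: "a_rk G (f ` Pref_morphism h) \<le> enat n"
    and D4: "h_injective h f"
  shows
    \<comment> \<open>O1\<close>
    "det (frequency_matrix h) \<noteq> 0 \<and>
     \<comment> \<open>O2\<close>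
     a_rk (Z_Sigma Mod image_subgroup h) (prefix_cosets h) \<le> enat n \<and>
     \<comment> \<open>O3\<close>
     (\<forall>v \<in> prefix_vectors h - (parikh ` letter_images h \<union> {0}).
        finite (prefix_class h v) \<and> card (prefix_class h v) \<le> 2) \<and>
     \<comment> \<open>an image \<open>h [t]\<close> may itself be a proper prefix of \<open>h [s]\<close>, and its Parikh vector is a
        generator of the subgroup\<close>
     (\<forall>s u. strict_prefix u (h [s]) \<and> u \<noteq> [] \<and> u \<notin> letter_images h \<longrightarrow>
        parikh u \<notin> image_subgroup h) \<and>
     (\<forall>v \<in> prefix_vectors h - (parikh ` letter_images h \<union> {0}). \<forall>w.
        prefix_class h v = {v, w} \<and> v \<noteq> w \<longrightarrow>
        (\<exists>!(p, q). v - w = parikh (h [p]) - parikh (h [q]) \<and>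
           v \<in> parikh ` Pref (h [p]) \<and> w \<in> parikh ` Pref (h [q])))"
proof -
  interpret injective_morphism G f h
    using assms by (intro injective_morphism.intro injective_morphism_axioms.intro) auto
  have "w \<in> prefix_class h v" if "prefix_class h v = {v, w}" for v w
    using that by simp
  then show ?thesis
    using D1 a_rk_prefix_cosets_le[OF D3] \<open>n \<ge> 4\<close> \<open>CARD('a) = 2\<close> finite_card_prefix_class
      parikh_proper_prefix_notin_image_subgroup ex1_letter_image_difference
    by auto
qed

end
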